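(* Let $b(m)$ denote the minimum number of edges of a rooted brush that is strongly $m$-universal for the class of rooted brushes. Then $b(m)=O(m\ln m)$.
   Context: A rooted tree is a tree with a distinguished vertex, the root. A rooted contraction of a rooted tree $T$ is a rooted tree obtained from $T$ by successively contracting edges (contraction of $\{a,b\}$ merges $a,b$ into one vertex adjacent to all former neighbours of $a$ or $b$), the root of the result being the image of the root of $T$. A rooted brush is a rooted tree in which all vertices of degree greater than $2$ lie on a single path starting at the root. A rooted tree $U$ is strongly $m$-universal for a class $C$ of rooted trees if every rooted tree in $C$ with $m$ edges is a rooted contraction of $U$. *)

theory Defs
  imports Complex_Main "HOL-Library.Landau_Symbols"
begin

record 'a rooted_graph =
  gverts :: "'a set"
  gedges :: "'a set set"
  groot  :: 'a

definition simple_graph :: "'a rooted_graph \<Rightarrow> bool" where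
  "simple_graph G \<longleftrightarrow>
     finite (gverts G) \<and> (\<forall>e\<in>gedges G. e \<subseteq> gverts G \<and> card e = 2)"

definition walk :: "'a rooted_graph \<Rightarrow> 'a list \<Rightarrow> bool" where
  "walk G p \<longleftrightarrow> p \<noteq> [] \<and> set p \<subseteq> gverts G \<and> successively (\<lambda>u v. {u, v} \<in> gedges G) p"

definition graph_path :: "'a rooted_graph \<Rightarrow> 'a list \<Rightarrow> bool" where
  "graph_path G p \<longleftrightarrow> walk G p \<and> distinct p"

definition graph_cycle :: "'a rooted_graph \<Rightarrow> 'a list \<Rightarrow> bool" where
  "graph_cycle G p \<longleftrightarrow> graph_path G p \<and> length p \<ge> 3 \<and> {last p, hd p} \<in> gedges G"

definition connected_graph :: "'a rooted_graph \<Rightarrow> bool" where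
  "connected_graph G \<longleftrightarrow>
     (\<forall>u\<in>gverts G. \<forall>v\<in>gverts G. \<exists>p. walk G p \<and> hd p = u \<and> last p = v)"

definition rooted_tree :: "'a rooted_graph \<Rightarrow> bool" where
  "rooted_tree T \<longleftrightarrow>
     simple_graph T \<and> connected_graph T \<and> (\<nexists>p. graph_cycle T p) \<and> groot T \<in> gverts T"

definition degree :: "'a rooted_graph \<Rightarrow> 'a \<Rightarrow> nat" where
  "degree G v = card {e \<in> gedges G. v \<in> e}"

definition rooted_brush :: "'a rooted_graph \<Rightarrow> bool" where
  "rooted_brush T \<longleftrightarrow>
     rooted_tree T \<and>
     (\<exists>p. graph_path T p \<and> hd p = groot T \<and> {v \<in> gverts T. degree T v > 2} \<subseteq> set p)"

(* The vertex arising from merging a and b is again called a; only the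
   isomorphism type of the result matters (see rooted_contraction). *)
definition contract_edge :: "'a \<Rightarrow> 'a \<Rightarrow> 'a rooted_graph \<Rightarrow> 'a rooted_graph" where
  "contract_edge a b G =
     (let f = id(b := a) in
      \<lparr> gverts = f ` gverts G,
        gedges = (\<lambda>e. f ` e) ` (gedges G - {{a, b}}),
        groot = f (groot G) \<rparr>)"

inductive contraction_step :: "'a rooted_graph \<Rightarrow> 'a rooted_graph \<Rightarrow> bool" where
  "{a, b} \<in> gedges G \<Longrightarrow> contraction_step G (contract_edge a b G)"

definition rooted_iso :: "'a rooted_graph \<Rightarrow> 'b rooted_graph \<Rightarrow> bool" where
  "rooted_iso G H \<longleftrightarrow>
     (\<exists>f. bij_betw f (gverts G) (gverts H) \<and>
          gedges H = (\<lambda>e. f ` e) ` gedges G \<and>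
          groot H = f (groot G))"

(* Read: S is (isomorphic to) a rooted contraction of T. *)
definition rooted_contraction :: "'b rooted_graph \<Rightarrow> 'a rooted_graph \<Rightarrow> bool" where
  "rooted_contraction S T \<longleftrightarrow> (\<exists>T'. contraction_step\<^sup>*\<^sup>* T T' \<and> rooted_iso T' S)"

definition strongly_universal ::
    "nat \<Rightarrow> 'b rooted_graph set \<Rightarrow> 'a rooted_graph \<Rightarrow> bool" where
  "strongly_universal m C U \<longleftrightarrow>
     rooted_tree U \<and> (\<forall>T\<in>C. card (gedges T) = m \<longrightarrow> rooted_contraction T U)"

(* Trees are finite, so vertices may be taken to be natural numbers: every
   isomorphism type of rooted brushes is represented. *)
definition universal_brush :: "nat \<Rightarrow> nat rooted_graph \<Rightarrow> bool" where
  "universal_brush m U \<longleftrightarrow>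
     rooted_brush U \<and> strongly_universal m {T :: nat rooted_graph. rooted_brush T} U"

(* LEAST is meaningful only if some universal brush exists. *)
definition min_brush_edges :: "nat \<Rightarrow> nat" where
  "min_brush_edges m = (LEAST n. \<exists>U. universal_brush m U \<and> card (gedges U) = n)"

end

theory Submission
  imports Defs "HOL-Library.Sublist" "HOL-Library.Nat_Bijection" "HOL-Real_Asymp.Real_Asymp"
begin

text \<open>A rooted brush is a spine with pendant paths; cutting it into columns (a spine vertex followed
  by at most one of the paths hanging there) turns it into a sequence of column sizes. With \<open>m\<close>
  edges these sizes have sum at most \<open>2 m + 2\<close>. Every sequence of positive numbers of sum below
  \<open>2 ^ q\<close> is dominated by a subsequence of the ruler sequence \<open>R (q + 1) = R q, 2 ^ (q + 1), R q\<close>,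
  whose sum is only \<open>q 2 ^ q\<close>. The comb with these column sizes contracts to the brush: columns that
  are not selected collapse into the spine, selected ones shrink to the required length, and
  neighbouring columns with the same spine vertex merge along the spine.\<close>

section \<open>Connectivity\<close>

text \<open>Adjacency as a relation, so that connectivity becomes membership in
  \<open>(adj G)\<^sup>*\<close> and can be proved by closure induction instead of by splicing
  lists.\<close>

definition adj :: "'a rooted_graph \<Rightarrow> ('a \<times> 'a) set" where
  "adj G = {(u, v). {u, v} \<in> gedges G}"

lemma sym_adj: "sym (adj G)"
  by (auto simp: adj_def sym_def insert_commute)

lemma simple_graph_edgeD:
  assumes "simple_graph G" "{u, v} \<in> gedges G"
  shows "u \<in> gverts G" "v \<in> gverts G" "u \<noteq> v"
proof -
  have "{u, v} \<subseteq> gverts G" "card {u, v} = 2"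
    using assms unfolding simple_graph_def by blast+
  then show "u \<in> gverts G" "v \<in> gverts G" "u \<noteq> v"
    by auto
qed

lemma finite_gedges: "simple_graph G \<Longrightarrow> finite (gedges G)"
  by (rule finite_subset[of _ "Pow (gverts G)"]) (auto simp: simple_graph_def)

lemma walk_imp_rtrancl:
  "walk G p \<Longrightarrow> (hd p, last p) \<in> (adj G)\<^sup>*"
proof (induction p)
  case (Cons x p)
  show ?case
  proof (cases p)
    case (Cons y p')
    with Cons.prems have "walk G p" "(x, y) \<in> adj G"
      by (auto simp: walk_def adj_def)
    with Cons.IH Cons show ?thesis
      by (auto intro: converse_rtrancl_into_rtrancl)
  qed simp
qed (simp add: walk_def)

text \<open>The path is built backwards from \<open>y\<close>. When the new vertex already lies on
  it, everything before that occurrence is cut off, which keeps the vertices distinct.\<close>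

lemma rtrancl_imp_path:
  assumes "simple_graph G" "(x, y) \<in> (adj G)\<^sup>*" "y \<in> gverts G"
  shows "\<exists>p. graph_path G p \<and> hd p = x \<and> last p = y"
  using assms(2)
proof (induction rule: converse_rtrancl_induct)
  case base
  have "graph_path G [y]"
    using assms(3) by (simp add: graph_path_def walk_def)
  then show ?case by (intro exI[of _ "[y]"]) simp
next
  case (step x z)
  then obtain p where p: "graph_path G p" "hd p = z" "last p = y"
    by blast
  have xz: "{x, z} \<in> gedges G"
    using step by (simp add: adj_def)
  show ?case
  proof (cases "x \<in> set p")
    case True
    then obtain as bs where "p = as @ x # bs"
      by (meson split_list)
    with p show ?thesis
      by (intro exI[of _ "x # bs"])
        (auto simp: graph_path_def walk_def successively_append_iff)
  next
    case False
    with p xz simple_graph_edgeD[OF assms(1) xz] show ?thesis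
      by (intro exI[of _ "x # p"])
        (auto simp: graph_path_def walk_def successively_Cons)
  qed
qed

lemma connected_graph_iff:
  assumes "simple_graph G"
  shows "connected_graph G \<longleftrightarrow> (\<forall>u\<in>gverts G. \<forall>v\<in>gverts G. (u, v) \<in> (adj G)\<^sup>*)"
proof
  assume "connected_graph G"
  then show "\<forall>u\<in>gverts G. \<forall>v\<in>gverts G. (u, v) \<in> (adj G)\<^sup>*"
    unfolding connected_graph_def by (metis walk_imp_rtrancl)
next
  assume "\<forall>u\<in>gverts G. \<forall>v\<in>gverts G. (u, v) \<in> (adj G)\<^sup>*"
  then show "connected_graph G"
    unfolding connected_graph_def
    using rtrancl_imp_path[OF assms] by (metis graph_path_def)
qed

section \<open>Crossing edges and the number of vertices\<close>

lemma crossing_edge: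
  assumes "simple_graph G" "connected_graph G" "W \<subseteq> gverts G" "W \<noteq> {}" "W \<noteq> gverts G"
  obtains u v where "u \<in> W" "v \<in> gverts G - W" "{u, v} \<in> gedges G"
proof -
  obtain x y where xy: "x \<in> W" "y \<in> gverts G" "y \<notin> W"
    using assms by blast
  then have "(x, y) \<in> (adj G)\<^sup>*"
    using assms connected_graph_iff by blast
  \<comment> \<open>If no edge left \<open>W\<close>, then \<open>W\<close> would absorb everything
    reachable from \<open>x\<close>, including \<open>y\<close>.\<close>
  moreover have "y \<in> W" if "(x, y) \<in> (adj G)\<^sup>*" "\<forall>u\<in>W. \<forall>v. {u, v} \<in> gedges G \<longrightarrow> v \<in> W"
    using that(1) by (induction rule: rtrancl_induct) (use xy that(2) in \<open>auto simp: adj_def\<close>)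
  ultimately obtain u v where uv: "u \<in> W" "v \<notin> W" "{u, v} \<in> gedges G"
    using xy(3) by blast
  with simple_graph_edgeD(2)[OF assms(1) uv(3)] show thesis
    by (intro that) auto
qed

text \<open>A vertex set is grown from a single vertex along crossing edges; each new vertex costs
  one new edge.\<close>

lemma card_gverts_le:
  assumes "simple_graph G" "connected_graph G"
  shows "card (gverts G) \<le> card (gedges G) + 1"
proof (cases "gverts G = {}")
  case False
  have fin: "finite (gverts G)"
    using assms(1) by (simp add: simple_graph_def)
  have grow: "\<exists>W F. W \<subseteq> gverts G \<and> card W = Suc n \<and> F \<subseteq> gedges G \<and> (\<forall>e\<in>F. e \<subseteq> W) \<and> card F = n"
    if "Suc n \<le> card (gverts G)" for n
    using that
  proof (induction n)
    case 0
    from False obtain x where "x \<in> gverts G" by blast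
    then show ?case by (intro exI[of _ "{x}"] exI[of _ "{}"]) auto
  next
    case (Suc n)
    then obtain W F where WF: "W \<subseteq> gverts G" "card W = Suc n" "F \<subseteq> gedges G"
      "\<forall>e\<in>F. e \<subseteq> W" "card F = n" by auto
    then have "W \<noteq> gverts G" "W \<noteq> {}" using Suc.prems by auto
    then obtain u v where uv: "u \<in> W" "v \<in> gverts G - W" "{u, v} \<in> gedges G"
      using crossing_edge[OF assms WF(1)] by blast
    have "finite W" "finite F"
      using WF fin finite_subset finite_gedges[OF assms(1)] by blast+
    \<comment> \<open>The chosen edges lie inside \<open>W\<close>, whereas \<open>v\<close> does
      not.\<close>
    moreover have "{u, v} \<notin> F" using WF(4) uv by auto
    ultimately show ?case
      using WF uv by (intro exI[of _ "insert v W"] exI[of _ "insert {u, v} F"]) auto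
  qed
  have "0 < card (gverts G)"
    using False fin by (simp add: card_gt_0_iff)
  then obtain F where F: "F \<subseteq> gedges G" "card F = card (gverts G) - 1"
    using grow[of "card (gverts G) - 1"] by auto
  show ?thesis
    using card_mono[OF finite_gedges[OF assms(1)] F(1)] F(2) by linarith
qed simp

section \<open>Contractions from maps with connected fibres\<close>

text \<open>Induction on the number of vertices. An edge inside a fibre is contracted, and
  \<open>f\<close> still describes the smaller graph; once no such edge is left, connected fibres
  are singletons and \<open>f\<close> is an isomorphism.\<close>

lemma rooted_contraction_if_connected_fibres:
  assumes "simple_graph G"
    and "f ` gverts G = gverts H"
    and "groot H = f (groot G)"
    and "gedges H = (\<lambda>e. f ` e) ` {e \<in> gedges G. card (f ` e) = 2}"
    and "\<And>u v. u \<in> gverts G \<Longrightarrow> v \<in> gverts G \<Longrightarrow> f u = f v \<Longrightarrow>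
           (u, v) \<in> {(x, y). (x, y) \<in> adj G \<and> f x = f y}\<^sup>*"
  shows "rooted_contraction H G"
  using assms
proof (induction "card (gverts G)" arbitrary: G rule: less_induct)
  case less
  note fibres = less.prems(5)
  show ?case
  proof (cases "\<exists>a b. {a, b} \<in> gedges G \<and> f a = f b")
    case False
    have inj: "inj_on f (gverts G)"
    proof (rule inj_onI)
      fix u v assume "u \<in> gverts G" "v \<in> gverts G" "f u = f v"
      from fibres[OF this] show "u = v"
        by (cases rule: converse_rtranclE) (use False in \<open>auto simp: adj_def\<close>)
    qed
    have "card (f ` e) = 2" if "e \<in> gedges G" for e
      using less.prems(1) that inj card_image[of f e]
      by (metis inj_on_subset simple_graph_def)
    then have "{e \<in> gedges G. card (f ` e) = 2} = gedges G" by blast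
    then have "rooted_iso G H"
      using inj less.prems(2,3,4) unfolding rooted_iso_def bij_betw_def by metis
    then show ?thesis
      unfolding rooted_contraction_def by blast
  next
    case True
    then obtain a b where ab: "{a, b} \<in> gedges G" "f a = f b" by blast
    note abV = simple_graph_edgeD[OF less.prems(1) ab(1)]
    define g where "g = id(b := a)"
    define G' where "G' = contract_edge a b G"
    have gv: "gverts G' = gverts G - {b}"
      using abV by (auto simp: G'_def contract_edge_def)
    have ge: "gedges G' = (\<lambda>e. g ` e) ` (gedges G - {{a, b}})"
      by (simp add: G'_def contract_edge_def g_def Let_def)
    have gr: "groot G' = g (groot G)"
      by (simp add: G'_def contract_edge_def g_def)
    have fg: "f (g x) = f x" for x
      using ab(2) by (simp add: g_def)
    have fge: "f ` g ` e = f ` e" for e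
      using fg by (auto simp: image_image)
    have gin: "g x \<in> gverts G'" if "x \<in> gverts G" for x
      using that abV gv by (auto simp: g_def)
    \<comment> \<open>Only \<open>a\<close> and \<open>b\<close> are identified, so an edge
      degenerates only if it contains both.\<close>
    have card_g: "card (g ` e) = 2" if "e \<in> gedges G - {{a, b}}" for e
    proof -
      have c2: "card e = 2" using that less.prems(1) by (auto simp: simple_graph_def)
      have "inj_on g e"
      proof (rule ccontr)
        assume "\<not> inj_on g e"
        then have "{a, b} \<subseteq> e" by (auto simp: inj_on_def g_def split: if_splits)
        moreover have "card {a, b} = 2" using abV by simp
        ultimately have "{a, b} = e"
          using c2 by (metis card_subset_eq card.infinite zero_neq_numeral)
        with that show False by blast
      qed
      with c2 show ?thesis by (simp add: card_image)
    qed
    have simple: "simple_graph G'"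
      unfolding simple_graph_def
    proof (intro conjI ballI)
      show "finite (gverts G')"
        using less.prems(1) gv by (simp add: simple_graph_def)
    next
      fix e assume "e \<in> gedges G'"
      then obtain e' where "e' \<in> gedges G - {{a, b}}" "e = g ` e'"
        using ge by blast
      moreover from this have "e' \<subseteq> gverts G"
        using less.prems(1) by (auto simp: simple_graph_def)
      ultimately show "e \<subseteq> gverts G'" "card e = 2"
        using card_g gin by auto
    qed
    have "f ` {a, b} = {f a}" using ab(2) by simp
    then have "card (f ` {a, b}) \<noteq> 2" by simp
    then have "{e \<in> gedges G. card (f ` e) = 2} = {e \<in> gedges G - {{a, b}}. card (f ` e) = 2}"
      by blast
    then have "gedges H = (\<lambda>e. f ` g ` e) ` {e \<in> gedges G - {{a, b}}. card (f ` g ` e) = 2}"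
      unfolding less.prems(4) fge by (rule arg_cong)
    also have "\<dots> = (\<lambda>e. f ` e) ` {e \<in> gedges G'. card (f ` e) = 2}"
      unfolding ge by blast
    finally have edges: "gedges H = (\<lambda>e. f ` e) ` {e \<in> gedges G'. card (f ` e) = 2}" .
    have verts: "f ` gverts G' = gverts H"
    proof -
      have "f b \<in> f ` (gverts G - {b})"
        unfolding ab(2)[symmetric] using abV by (intro imageI) simp
      moreover have "f ` gverts G = insert (f b) (f ` (gverts G - {b}))"
        using abV by blast
      ultimately show ?thesis
        unfolding less.prems(2)[symmetric] gv by (simp add: insert_absorb)
    qed
    have "(u, v) \<in> {(x, y). (x, y) \<in> adj G' \<and> f x = f y}\<^sup>*"
      if uv: "u \<in> gverts G'" "v \<in> gverts G'" "f u = f v" for u v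
    proof -
      \<comment> \<open>Under \<open>g\<close> a step of \<open>G\<close> either stays put or
        becomes a step of \<open>G'\<close>, so chains inside a fibre survive the
        contraction.\<close>
      have adj_g: "g x = g y \<or> (g x, g y) \<in> adj G'" if "(x, y) \<in> adj G" for x y
      proof (cases "{x, y} = {a, b}")
        case True
        then show ?thesis by (auto simp: g_def doubleton_eq_iff)
      next
        case False
        then have "g ` {x, y} \<in> gedges G'"
          using that unfolding ge adj_def by blast
        then show ?thesis by (simp add: adj_def)
      qed
      have "(u, v) \<in> {(x, y). (x, y) \<in> adj G \<and> f x = f y}\<^sup>*"
        using fibres uv gv by blast
      then have "(g u, g v) \<in> {(x, y). (x, y) \<in> adj G' \<and> f x = f y}\<^sup>*"
      proof (induction rule: rtrancl_induct)
        case (step y z)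
        then have "(y, z) \<in> adj G" "f (g y) = f (g z)" by (simp_all add: fg)
        then have "g y = g z \<or> (g y, g z) \<in> {(x, y). (x, y) \<in> adj G' \<and> f x = f y}"
          using adj_g by blast
        with step.IH show ?case
          by (elim disjE) (simp, rule rtrancl_into_rtrancl)
      qed simp
      moreover have "g u = u" "g v = v" using uv gv by (auto simp: g_def)
      ultimately show ?thesis by simp
    qed
    moreover have "card (gverts G') < card (gverts G)"
      unfolding gv using abV less.prems(1) by (intro card_Diff1_less) (auto simp: simple_graph_def)
    moreover have "groot H = f (groot G')"
      using less.prems(3) gr fg by simp
    ultimately have "rooted_contraction H G'"
      using simple verts edges by (intro less.hyps)
    moreover have "contraction_step G G'"
      unfolding G'_def using ab(1) by (rule contraction_step.intros)
    ultimately show ?thesis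
      unfolding rooted_contraction_def by (blast intro: converse_rtranclp_into_rtranclp)
  qed
qed

text \<open>The image of a connected graph is connected, so in a tree it already contains every edge.\<close>

lemma rooted_contraction_of_tree:
  assumes G: "simple_graph G" "connected_graph G" and H: "rooted_tree H"
    and verts: "f ` gverts G = gverts H"
    and root: "groot H = f (groot G)"
    and edges: "\<And>u v. {u, v} \<in> gedges G \<Longrightarrow> f u = f v \<or> {f u, f v} \<in> gedges H"
    and fibres: "\<And>u v. u \<in> gverts G \<Longrightarrow> v \<in> gverts G \<Longrightarrow> f u = f v \<Longrightarrow>
           (u, v) \<in> {(x, y). (x, y) \<in> adj G \<and> f x = f y}\<^sup>*"
  shows "rooted_contraction H G"
proof (rule rooted_contraction_if_connected_fibres[OF G(1) verts root _ fibres])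
  define F where "F = (\<lambda>e. f ` e) ` {e \<in> gedges G. card (f ` e) = 2}"
  \<comment> \<open>\<open>H'\<close> has the vertices of \<open>H\<close> but only the edges coming
    from \<open>G\<close>; it is connected as an image of \<open>G\<close>.\<close>
  define H' where "H' = H\<lparr>gedges := F\<rparr>"
  have simpleH: "simple_graph H" using H by (simp add: rooted_tree_def)
  have pair: "\<exists>u v. e = {u, v}" if "e \<in> gedges G" for e
    using G(1) that unfolding simple_graph_def card_2_iff by blast
  have FH: "F \<subseteq> gedges H"
  proof
    fix e assume "e \<in> F"
    then obtain e' where e': "e' \<in> gedges G" "card (f ` e') = 2" "e = f ` e'"
      by (auto simp: F_def)
    moreover from pair e'(1) obtain u v where "e' = {u, v}" by blast
    ultimately show "e \<in> gedges H" using edges[of u v] by auto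
  qed
  then have simple': "simple_graph H'"
    using simpleH by (auto simp: H'_def simple_graph_def)
  have mono: "(f u, f v) \<in> (adj H')\<^sup>*" if "(u, v) \<in> (adj G)\<^sup>*" for u v
    using that
  proof (induction rule: rtrancl_induct)
    case (step y z)
    have "f y = f z \<or> (f y, f z) \<in> adj H'"
    proof (cases "f y = f z")
      case False
      then have "f ` {y, z} \<in> F"
        unfolding F_def using step.hyps by (intro imageI) (auto simp: adj_def)
      then show ?thesis by (simp add: adj_def H'_def)
    qed simp
    with step.IH show ?case by (metis rtrancl.rtrancl_into_rtrancl)
  qed simp
  have "gedges H \<subseteq> F"
  proof
    fix e assume e: "e \<in> gedges H"
    then obtain x y where xy: "e = {x, y}" "x \<noteq> y" "x \<in> gverts H" "y \<in> gverts H"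
      using simpleH by (auto simp: simple_graph_def card_2_iff)
    then obtain u v where "u \<in> gverts G" "v \<in> gverts G" "x = f u" "y = f v"
      using verts by blast
    then have "(x, y) \<in> (adj H')\<^sup>*"
      using mono G connected_graph_iff by blast
    then obtain p where p: "graph_path H' p" "hd p = x" "last p = y"
      using rtrancl_imp_path[OF simple'] xy by (auto simp: H'_def)
    have "graph_path H p"
      using p(1) FH unfolding graph_path_def walk_def H'_def
      by (auto elim: successively_mono)
    \<comment> \<open>A path in \<open>H'\<close> with three or more vertices would close up with
      the edge \<open>e\<close> to a cycle in \<open>H\<close>. Hence the path is the edge
      \<open>e\<close> itself, which therefore belongs to \<open>F\<close>.\<close>
    then have "\<not> length p \<ge> 3"
      using H e p xy by (auto simp: rooted_tree_def graph_cycle_def insert_commute)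
    moreover have "p \<noteq> []" using p by (simp add: graph_path_def walk_def)
    ultimately consider z where "p = [z]" | z w where "p = [z, w]"
      by (cases p; cases "tl p"; cases "tl (tl p)") auto
    then show "e \<in> F"
      using p xy by cases (auto simp: graph_path_def walk_def H'_def)
  qed
  with FH show "gedges H = (\<lambda>e. f ` e) ` {e \<in> gedges G. card (f ` e) = 2}"
    unfolding F_def by blast
qed

section \<open>Trees given by a parent function\<close>

definition parent_graph :: "'a set \<Rightarrow> 'a \<Rightarrow> ('a \<Rightarrow> 'a) \<Rightarrow> 'a rooted_graph" where
  "parent_graph V r par = \<lparr>gverts = V, gedges = (\<lambda>v. {v, par v}) ` (V - {r}), groot = r\<rparr>"

lemma parent_graph_simps [simp]:
  "gverts (parent_graph V r par) = V"
  "gedges (parent_graph V r par) = (\<lambda>v. {v, par v}) ` (V - {r})"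
  "groot (parent_graph V r par) = r"
  by (simp_all add: parent_graph_def)

text \<open>The strictly decreasing \<open>rank\<close> makes climbing to the root terminate and
  rules out cycles.\<close>

locale parent_tree =
  fixes V :: "'a set" and r :: 'a and par :: "'a \<Rightarrow> 'a" and rank :: "'a \<Rightarrow> nat"
  assumes finite_V: "finite V"
    and root_in_V: "r \<in> V"
    and par_in_V: "v \<in> V \<Longrightarrow> v \<noteq> r \<Longrightarrow> par v \<in> V"
    and rank_par: "v \<in> V \<Longrightarrow> v \<noteq> r \<Longrightarrow> rank (par v) < rank v"
begin

abbreviation "T \<equiv> parent_graph V r par"

lemma edge_cases:
  assumes "{u, v} \<in> gedges T"
  obtains "u \<in> V" "u \<noteq> r" "v = par u" | "v \<in> V" "v \<noteq> r" "u = par v"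
proof -
  from assms obtain w where w: "w \<in> V" "w \<noteq> r" "{u, v} = {w, par w}"
    by auto
  then consider "u = w" "v = par w" | "v = w" "u = par w"
    by (auto simp: doubleton_eq_iff)
  with w that show thesis by cases blast+
qed

lemma adj_par: "v \<in> V \<Longrightarrow> v \<noteq> r \<Longrightarrow> (v, par v) \<in> adj T"
  by (auto simp: adj_def)

lemma simple: "simple_graph T"
  using finite_V par_in_V rank_par by (fastforce simp: simple_graph_def card_2_iff)

lemma reaches_root: "v \<in> V \<Longrightarrow> (v, r) \<in> (adj T)\<^sup>*"
proof (induction "rank v" arbitrary: v rule: less_induct)
  case less
  show ?case
  proof (cases "v = r")
    case False
    then have "(par v, r) \<in> (adj T)\<^sup>*"
      using less par_in_V rank_par by simp
    with adj_par[OF less.prems False] show ?thesis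
      by (rule converse_rtrancl_into_rtrancl)
  qed simp
qed

lemma connected: "connected_graph T"
  unfolding connected_graph_iff[OF simple] parent_graph_simps
  using reaches_root symD[OF sym_rtrancl[OF sym_adj]] rtrancl_trans by metis

text \<open>Both cycle neighbours of a vertex of maximal rank on a cycle would have to be its parent.\<close>

lemma acyclic: "\<not> graph_cycle T p"
proof
  assume cyc: "graph_cycle T p"
  then have p: "distinct p" "length p \<ge> 3" "set p \<subseteq> V" "successively (\<lambda>u v. {u, v} \<in> gedges T) p"
    "{last p, hd p} \<in> gedges T"
    by (auto simp: graph_cycle_def graph_path_def walk_def)
  then have "set p \<noteq> {}" by auto
  then have "Max (rank ` set p) \<in> rank ` set p"
    by (intro Max_in) auto
  then obtain v where v: "v \<in> set p" "rank v = Max (rank ` set p)"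
    by auto
  have v_max: "rank w \<le> rank v" if "w \<in> set p" for w
    unfolding v(2) using that by simp
  obtain as bs where asbs: "p = as @ v # bs"
    using v(1) by (meson split_list)
  obtain x y where xy: "x \<in> set p" "y \<in> set p" "x \<noteq> y" "{v, x} \<in> gedges T" "{v, y} \<in> gedges T"
  proof -
    \<comment> \<open>The neighbours of \<open>v\<close> before and after it in cyclic order; having
      at least three vertices on the cycle makes them distinct.\<close>
    define x where "x = (if as = [] then last p else last as)"
    define y where "y = (if bs = [] then hd p else hd bs)"
    have "{v, x} \<in> gedges T" "{v, y} \<in> gedges T"
      using p(4,5) unfolding asbs x_def y_def
      by (auto simp: successively_append_iff successively_Cons insert_commute
          simp del: parent_graph_simps split: if_splits)
    moreover have "x \<in> set p" "y \<in> set p"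
      using last_in_set[of p] last_in_set[of as] hd_in_set[of p] hd_in_set[of bs]
      unfolding x_def y_def by (auto simp: asbs)
    moreover have "x \<noteq> y"
    proof (cases "as = []"; cases "bs = []")
      assume "as = []" "bs \<noteq> []"
      then obtain b c bs' where "bs = b # c # bs'"
        using p(2) asbs by (cases bs; cases "tl bs") auto
      then show ?thesis using p(1) asbs \<open>as = []\<close>
        by (auto simp: x_def y_def split: if_splits)
    next
      assume "as \<noteq> []" "bs = []"
      then obtain b c as' where "as = b # c # as'"
        using p(2) asbs by (cases as; cases "tl as") auto
      then show ?thesis using p(1) asbs \<open>bs = []\<close>
        by (auto simp: x_def y_def split: if_splits)
    next
      assume "as \<noteq> []" "bs \<noteq> []"
      then have "x \<in> set as" "y \<in> set bs" by (simp_all add: x_def y_def)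
      then show ?thesis using p(1) asbs by auto
    qed (use p(2) asbs in auto)
    ultimately show thesis by (rule that[rotated 3])
  qed
  have "w = par v" if "w \<in> set p" "{v, w} \<in> gedges T" for w
    using that(2)
  proof (cases rule: edge_cases)
    case 2
    with rank_par[of w] v_max[OF that(1)] show ?thesis by simp
  qed
  with xy show False by metis
qed

lemma tree: "rooted_tree T"
  using simple connected acyclic root_in_V by (simp add: rooted_tree_def)

text \<open>An edge \<open>{v, par v}\<close> determines \<open>v\<close> as its end of larger
  rank.\<close>

lemma card_edges: "card (gedges T) = card V - 1"
proof -
  have "inj_on (\<lambda>v. {v, par v}) (V - {r})"
  proof (rule inj_onI)
    fix v w assume "v \<in> V - {r}" "w \<in> V - {r}" "{v, par v} = {w, par w}"
    with rank_par[of v] rank_par[of w] show "v = w"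
      by (auto simp: doubleton_eq_iff)
  qed
  then show ?thesis
    using root_in_V by (simp add: card_image)
qed

text \<open>Climbing towards the root inside a fibre ends in a vertex that is the root or whose
  parent lies in another fibre; so it suffices that each fibre has only one such vertex.\<close>

lemma connected_fibres:
  assumes top: "\<And>u v. u \<in> V \<Longrightarrow> v \<in> V \<Longrightarrow> u = r \<or> f (par u) \<noteq> f u \<Longrightarrow>
      v = r \<or> f (par v) \<noteq> f v \<Longrightarrow> f u = f v \<Longrightarrow> u = v"
    and uv: "u \<in> V" "v \<in> V" "f u = f v"
  shows "(u, v) \<in> {(x, y). (x, y) \<in> adj T \<and> f x = f y}\<^sup>*"
proof -
  define R where "R = {(x, y). (x, y) \<in> adj T \<and> f x = f y}"
  have "sym R"
    using sym_adj[of T] by (auto simp: R_def sym_def)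
  have climb: "\<exists>t\<in>V. (t = r \<or> f (par t) \<noteq> f t) \<and> f t = f u \<and> (u, t) \<in> R\<^sup>*" if "u \<in> V" for u
    using that
  proof (induction "rank u" arbitrary: u rule: less_induct)
    case less
    show ?case
    proof (cases "u = r \<or> f (par u) \<noteq> f u")
      case False
      then obtain t where t: "t \<in> V" "t = r \<or> f (par t) \<noteq> f t" "f t = f u" "(par u, t) \<in> R\<^sup>*"
        using less par_in_V rank_par by metis
      moreover have "(u, par u) \<in> R"
        using adj_par[OF less.prems] False by (simp add: R_def)
      ultimately show ?thesis
        by (intro bexI[of _ t]) (auto intro: converse_rtrancl_into_rtrancl)
    qed (use less.prems in blast)
  qed
  obtain s where s: "s \<in> V" "s = r \<or> f (par s) \<noteq> f s" "f s = f u" "(u, s) \<in> R\<^sup>*"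
    using climb[OF uv(1)] by blast
  obtain t where t: "t \<in> V" "t = r \<or> f (par t) \<noteq> f t" "f t = f v" "(v, t) \<in> R\<^sup>*"
    using climb[OF uv(2)] by blast
  have "s = t"
    by (rule top[OF s(1) t(1) s(2) t(2)]) (simp add: s(3) t(3) uv(3))
  moreover have "(t, v) \<in> R\<^sup>*"
    using t(4) by (rule symD[OF sym_rtrancl[OF \<open>sym R\<close>]])
  ultimately have "(u, v) \<in> R\<^sup>*"
    using s(4) by (blast intro: rtrancl_trans)
  then show ?thesis by (simp only: R_def)
qed

end

section \<open>Combs\<close>

text \<open>The pair \<open>(i, j)\<close> is the vertex at distance \<open>j\<close> from the spine in the \<open>i\<close>-th column,
  and \<open>A ! i\<close> counts the vertices of that column including the one on the spine.\<close>

definition comb_verts :: "nat list \<Rightarrow> (nat \<times> nat) set" where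
  "comb_verts A = (SIGMA i:{..<length A}. {..<A ! i})"

definition comb_par :: "nat \<times> nat \<Rightarrow> nat \<times> nat" where
  "comb_par = (\<lambda>(i, j). if j = 0 then (i - 1, 0) else (i, j - 1))"

text \<open>Pairs are encoded as numbers because \<open>universal_brush\<close> speaks of graphs on
  the naturals.\<close>

definition comb :: "nat list \<Rightarrow> nat rooted_graph" where
  "comb A = parent_graph (prod_encode ` comb_verts A) (prod_encode (0, 0))
     (\<lambda>v. prod_encode (comb_par (prod_decode v)))"

text \<open>The rank \<open>i + j\<close> is the distance from the root. Positive column sizes
  ensure that every column has its spine vertex.\<close>

lemma parent_tree_comb:
  assumes "A \<noteq> []" "0 \<notin> set A"
  shows "parent_tree (prod_encode ` comb_verts A) (prod_encode (0, 0))
     (\<lambda>v. prod_encode (comb_par (prod_decode v))) (\<lambda>v. case prod_decode v of (i, j) \<Rightarrow> i + j)"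
proof
  have pos: "0 < A ! i" if "i < length A" for i
    using assms(2) that by (metis gr0I nth_mem)
  show "finite (prod_encode ` comb_verts A)"
    by (simp add: comb_verts_def)
  show "prod_encode (0, 0) \<in> prod_encode ` comb_verts A"
    using pos assms(1) by (simp add: comb_verts_def)
  fix v assume "v \<in> prod_encode ` comb_verts A" "v \<noteq> prod_encode (0, 0)"
  then obtain i j where "v = prod_encode (i, j)" "i < length A" "j < A ! i" "(i, j) \<noteq> (0, 0)"
    by (auto simp: comb_verts_def)
  then show "prod_encode (comb_par (prod_decode v)) \<in> prod_encode ` comb_verts A"
    "(case prod_decode (prod_encode (comb_par (prod_decode v))) of (i, j) \<Rightarrow> i + j)
       < (case prod_decode v of (i, j) \<Rightarrow> i + j)"
    using pos[of "i - 1"] by (auto simp: comb_par_def comb_verts_def)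
qed

lemma card_comb_edges:
  assumes "A \<noteq> []" "0 \<notin> set A"
  shows "card (gedges (comb A)) = sum_list A - 1"
proof -
  have "card (comb_verts A) = sum_list A"
    by (simp add: comb_verts_def sum_list_sum_nth lessThan_atLeast0)
  then show ?thesis
    unfolding comb_def parent_tree.card_edges[OF parent_tree_comb[OF assms]]
    by (simp add: card_image inj_prod_encode)
qed

lemma comb_brush:
  assumes "A \<noteq> []" "0 \<notin> set A"
  shows "rooted_brush (comb A)"
  unfolding rooted_brush_def
proof (intro conjI exI)
  show "rooted_tree (comb A)"
    unfolding comb_def by (rule parent_tree.tree[OF parent_tree_comb[OF assms]])
  let ?p = "map (\<lambda>i. prod_encode (i, 0)) [0..<length A]"
  have pos: "0 < A ! i" if "i < length A" for i
    using assms(2) that by (metis gr0I nth_mem)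
  have "{prod_encode (i, 0), prod_encode (Suc i, 0)} \<in> gedges (comb A)" if "Suc i < length A" for i
    using that pos[OF that] unfolding comb_def
    by (auto simp: comb_verts_def comb_par_def insert_commute
        intro!: image_eqI[of _ _ "prod_encode (Suc i, 0)"])
  then have "successively (\<lambda>u v. {u, v} \<in> gedges (comb A)) ?p"
    by (simp add: successively_map successively_conv_nth)
  moreover have "set ?p \<subseteq> gverts (comb A)"
    using pos by (auto simp: comb_def comb_verts_def)
  moreover have "distinct ?p"
    by (auto simp: distinct_map inj_on_def)
  ultimately show "graph_path (comb A) ?p"
    using assms(1) by (simp add: graph_path_def walk_def)
  show "hd ?p = groot (comb A)"
    using assms(1) by (simp add: comb_def hd_map)
  show "{v \<in> gverts (comb A). degree (comb A) v > 2} \<subseteq> set ?p"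
  proof
    fix v assume "v \<in> {v \<in> gverts (comb A). degree (comb A) v > 2}"
    then obtain i j where v: "v = prod_encode (i, j)" "i < length A" "degree (comb A) v > 2"
      by (auto simp: comb_def comb_verts_def)
    have "j = 0"
    proof (rule ccontr)
      assume "j \<noteq> 0"
      \<comment> \<open>Off the spine, a vertex meets only the edge to its parent and possibly one
        to the next vertex of its column.\<close>
      then have "{e \<in> gedges (comb A). v \<in> e} \<subseteq>
          {{v, prod_encode (i, j - 1)}, {prod_encode (i, Suc j), v}}"
        unfolding v(1) comb_def by (auto simp: comb_par_def split: if_splits)
      then have "degree (comb A) v \<le> card {{v, prod_encode (i, j - 1)}, {prod_encode (i, Suc j), v}}"
        unfolding degree_def by (intro card_mono) auto
      also have "\<dots> \<le> 2"
        by (simp add: card_insert_if)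
      finally show False using v(3) by simp
    qed
    with v show "v \<in> set ?p" by auto
  qed
qed

section \<open>Collapsing a comb onto a tree laid out in columns\<close>

text \<open>A tree is laid out as columns \<open>Q \<in> set M\<close>: the heads run along the spine \<open>p\<close>, possibly
  repeating, and the tails are the paths attached to it.\<close>

definition layout :: "'a rooted_graph \<Rightarrow> 'a list \<Rightarrow> 'a list list \<Rightarrow> bool" where
  "layout G p M \<longleftrightarrow>
     (\<forall>Q\<in>set M. Q \<noteq> [] \<and> successively (\<lambda>u v. {u, v} \<in> gedges G) Q) \<and>
     remdups_adj (map hd M) = p \<and> distinct (p @ concat (map tl M))"

text \<open>Serves to recover the column and the height of a vertex off the spine from its image in
  the laid-out tree.\<close>

lemma distinct_concat_nth_unique:
  assumes "distinct (concat xss)" "i < length xss" "k < length xss"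
    "a < length (xss ! i)" "b < length (xss ! k)" "xss ! i ! a = xss ! k ! b"
  shows "i = k \<and> a = b"
  using assms
proof (induction xss arbitrary: i k)
  case (Cons xs xss)
  have disj: "xs ! c \<noteq> xss ! l ! d" if "c < length xs" "l < length xss" "d < length (xss ! l)" for c l d
  proof -
    have "xs ! c \<in> set xs" "xss ! l \<in> set xss" "xss ! l ! d \<in> set (xss ! l)"
      using that by simp_all
    then show ?thesis
      using Cons.prems(1) by auto
  qed
  show ?case
  proof (cases i; cases k)
    fix i' k' assume "i = Suc i'" "k = Suc k'"
    then show ?thesis using Cons.IH[of i' k'] Cons.prems by simp
  qed (use Cons.prems disj disj[symmetric] nth_eq_iff_index_eq[of xs a b] in auto)
qed simp

text \<open>Column \<open>i\<close> of the comb is mapped along \<open>M ! i\<close>. Each fibre has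
  a single topmost vertex: over the spine because columns with equal heads are consecutive,
  elsewhere because the tails are disjoint and free of repetitions.\<close>

lemma comb_contraction:
  assumes G: "rooted_tree G" and p: "graph_path G p" "hd p = groot G"
    and lay: "layout G p M" and cover: "set p \<union> set (concat (map tl M)) = gverts G"
    and fit: "list_all2 (\<lambda>Q a. length Q \<le> a) M A"
  shows "rooted_contraction G (comb A)"
proof -
  have Q: "Q \<noteq> []" "successively (\<lambda>u v. {u, v} \<in> gedges G) Q" if "Q \<in> set M" for Q
    using lay that by (auto simp: layout_def)
  have spine: "remdups_adj (map hd M) = p" and dist: "distinct p" "distinct (concat (map tl M))"
    "set p \<inter> set (concat (map tl M)) = {}"
    using lay by (auto simp: layout_def)
  have len: "length M = length A" "\<And>i. i < length M \<Longrightarrow> length (M ! i) \<le> A ! i"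
    using fit by (auto simp: list_all2_conv_all_nth)
  have M_pos: "0 < length (M ! i)" if "i < length M" for i
    using Q(1)[OF nth_mem[OF that]] by simp
  have "p \<noteq> []" using p by (simp add: graph_path_def walk_def)
  then have "M \<noteq> []" using spine by auto
  then have A: "A \<noteq> []" using len by auto
  have A0: "0 \<notin> set A"
    using len M_pos by (metis in_set_conv_nth le_zero_eq less_irrefl)
  interpret U: parent_tree "prod_encode ` comb_verts A" "prod_encode (0, 0)"
    "\<lambda>v. prod_encode (comb_par (prod_decode v))" "\<lambda>v. case prod_decode v of (i, j) \<Rightarrow> i + j"
    by (rule parent_tree_comb[OF A A0])
  \<comment> \<open>The surplus of a column beyond the length of \<open>M ! i\<close> collapses onto
    the last entry; a one-entry column collapses onto the spine.\<close>
  define g where "g = (\<lambda>i j. M ! i ! min j (length (M ! i) - 1))"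
  define f where "f = (\<lambda>v. case prod_decode v of (i, j) \<Rightarrow> g i j)"
  have f_enc: "f (prod_encode (i, j)) = g i j" for i j
    by (simp add: f_def)
  have g0: "g i 0 = map hd M ! i" "g i 0 = hd (M ! i)" if "i < length M" for i
    using that M_pos[OF that] by (simp_all add: g_def hd_conv_nth)
  have g_tl: "g i j = map tl M ! i ! (j - 1)" "j - 1 < length (map tl M ! i)"
    if "i < length M" "0 < j" "j < length (M ! i)" for i j
    using that by (auto simp: g_def nth_tl min_def)
  have g_over: "g i j = g i (j - 1)" if "length (M ! i) \<le> j" for i j
  proof -
    have "min j (length (M ! i) - 1) = min (j - 1) (length (M ! i) - 1)"
      using that by arith
    then show ?thesis by (simp add: g_def)
  qed
  have g0_in: "g i 0 \<in> set p" if "i < length M" for i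
    unfolding spine[symmetric] remdups_adj_set g0(1)[OF that] using that by simp
  have g_tl_in: "g i j \<in> set (concat (map tl M))" if "i < length M" "0 < j" "j < length (M ! i)" for i j
  proof -
    have "g i j \<in> set (map tl M ! i)" using g_tl[OF that] by simp
    moreover have "map tl M ! i \<in> set (map tl M)" using that by simp
    ultimately show ?thesis by auto
  qed
  have g_in: "g i j \<in> gverts G" if "i < length M" for i j
  proof (induction j)
    case 0 then show ?case using g0_in[OF that] cover by blast
  next
    case (Suc j)
    then show ?case
      using g_over[of i "Suc j"] g_tl_in[OF that, of "Suc j"] cover
      by (cases "Suc j < length (M ! i)") auto
  qed
  have root: "g 0 0 = groot G"
    using p(2) g0(2)[of 0] \<open>M \<noteq> []\<close> unfolding spine[symmetric]
    by (simp add: hd_map hd_conv_nth)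
  have verts: "f ` prod_encode ` comb_verts A = gverts G"
  proof (intro subset_antisym subsetI)
    fix x assume "x \<in> f ` prod_encode ` comb_verts A"
    then show "x \<in> gverts G"
      using g_in len by (auto simp: comb_verts_def f_enc)
  next
    fix x assume "x \<in> gverts G"
    then consider "x \<in> set (map hd M)" | "x \<in> set (concat (map tl M))"
      unfolding cover[symmetric] spine[symmetric] by auto
    then obtain i j where "i < length M" "j < length (M ! i)" "x = g i j"
    proof cases
      case 1
      then obtain i where "i < length M" "x = map hd M ! i"
        by (auto simp: in_set_conv_nth)
      then show thesis using that[of i 0] g0 M_pos by simp
    next
      case 2
      then obtain Q where "Q \<in> set M" "x \<in> set (tl Q)" by auto
      then obtain i where i: "i < length M" "x \<in> set (tl (M ! i))"
        by (metis in_set_conv_nth)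
      then obtain j where "j < length (tl (M ! i))" "x = tl (M ! i) ! j"
        by (metis in_set_conv_nth)
      then show thesis using that[of i "Suc j"] g_tl(1)[of i "Suc j"] i by simp
    qed
    moreover from this have "(i, j) \<in> comb_verts A"
      using len(1) len(2)[of i] by (simp add: comb_verts_def)
    ultimately show "x \<in> f ` prod_encode ` comb_verts A"
      using f_enc by (metis imageI)
  qed
  have par_edge: "g i j = (case comb_par (i, j) of (k, l) \<Rightarrow> g k l) \<or>
      {g i j, case comb_par (i, j) of (k, l) \<Rightarrow> g k l} \<in> gedges G"
    if ij: "i < length M" "(i, j) \<noteq> (0, 0)" for i j
  proof (cases "j = 0")
    case True
    have "successively (\<lambda>u v. {u, v} \<in> gedges G) p"
      using p(1) by (simp add: graph_path_def walk_def)
    \<comment> \<open>Allowing equality makes the relation reflexive, so it transfers from the list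
      without adjacent repetitions to all heads.\<close>
    then have "successively (\<lambda>u v. u = v \<or> {u, v} \<in> gedges G) (remdups_adj (map hd M))"
      unfolding spine by (rule successively_mono) simp
    then have "successively (\<lambda>u v. u = v \<or> {u, v} \<in> gedges G) (map hd M)"
      by (subst (asm) successively_remdups_adj_iff) auto
    from successively_nth[OF this, of "i - 1"]
    have "g (i - 1) 0 = g i 0 \<or> {g (i - 1) 0, g i 0} \<in> gedges G"
      using ij True g0(1)[of i] g0(1)[of "i - 1"] by simp
    with True show ?thesis by (auto simp: comb_par_def insert_commute)
  next
    case False
    show ?thesis
    proof (cases "j < length (M ! i)")
      case True
      with successively_nth[OF Q(2)[OF nth_mem[OF ij(1)]], of "j - 1"] False
      have "{M ! i ! (j - 1), M ! i ! j} \<in> gedges G" by simp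
      with True False show ?thesis
        by (auto simp: comb_par_def g_def min_def insert_commute)
    qed (use False g_over in \<open>simp add: comb_par_def\<close>)
  qed
  have mono_spine: "i = k"
    if "i < length M" "k < length M" "g i 0 = g k 0" "i = 0 \<or> g (i - 1) 0 \<noteq> g i 0"
      "k = 0 \<or> g (k - 1) 0 \<noteq> g k 0" for i k
  proof -
    \<comment> \<open>\<open>s\<close> sends each column to the position of its head on
      \<open>p\<close>. Being monotone, it is constant between two columns with the same head, so a
      run of equal heads starts only once.\<close>
    from spine[unfolded remdups_adj_altdef] obtain s where
      s: "mono s" "s ` {0..<length M} = {0..<length p}" "\<And>i. i < length M \<Longrightarrow> map hd M ! i = p ! s i"
      by auto
    have s_less: "s i < length p" if "i < length M" for i
      using s(2) that by (metis atLeastLessThan_iff image_eqI le0)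
    have no_gap: False
      if less: "i < k" "k < length M" "g i 0 = g k 0" "g (k - 1) 0 \<noteq> g k 0" for i k
    proof -
      have "s i = s k"
        using less s(3)[of i] s(3)[of k] g0(1)[of i] g0(1)[of k] s_less[of i] s_less[of k] dist(1)
        by (simp add: nth_eq_iff_index_eq)
      moreover have "s i \<le> s (k - 1)" "s (k - 1) \<le> s k"
        using less s(1) by (auto intro: monoD)
      ultimately have "s (k - 1) = s k" by simp
      then show False
        using less s(3)[of k] s(3)[of "k - 1"] g0(1)[of k] g0(1)[of "k - 1"] by simp
    qed
    consider "i < k" | "i = k" | "k < i" by linarith
    then show ?thesis
      using no_gap[of i k] no_gap[of k i] that by cases auto
  qed
  have fibres: "(i, j) = (k, l)"
    if ij: "i < length M" "(i, j) = (0, 0) \<or> (case comb_par (i, j) of (k, l) \<Rightarrow> g k l) \<noteq> g i j"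
      and kl: "k < length M" "(k, l) = (0, 0) \<or> (case comb_par (k, l) of (k, l) \<Rightarrow> g k l) \<noteq> g k l"
      and eq: "g i j = g k l" for i j k l
  proof -
    \<comment> \<open>A vertex in the surplus of its column has the same image as its parent, so it
      is not topmost in its fibre.\<close>
    have short: "j < length (M ! i)"
      if "i < length M" "(i, j) = (0, 0) \<or> (case comb_par (i, j) of (k, l) \<Rightarrow> g k l) \<noteq> g i j" for i j
      using that g_over[of i j] M_pos[of i] by (cases "j = 0"; cases "j < length (M ! i)") (auto simp: comb_par_def)
    note j = short[OF ij] and l = short[OF kl]
    show ?thesis
    proof (cases "j = 0"; cases "l = 0")
      assume "j = 0" "l = 0"
      then show ?thesis
        using mono_spine[of i k] ij kl eq by (auto simp: comb_par_def)
    next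
      assume "j = 0" "l \<noteq> 0"
      then show ?thesis using g0_in[OF ij(1)] g_tl_in[OF kl(1) _ l] eq dist(3) by auto
    next
      assume "j \<noteq> 0" "l = 0"
      then show ?thesis using g0_in[OF kl(1)] g_tl_in[OF ij(1) _ j] eq dist(3) by auto
    next
      assume "j \<noteq> 0" "l \<noteq> 0"
      then have "i = k \<and> j - 1 = l - 1"
        using distinct_concat_nth_unique[OF dist(2), of i k "j - 1" "l - 1"] ij(1) kl(1) eq
          g_tl[OF ij(1) _ j] g_tl[OF kl(1) _ l] by simp
      with \<open>j \<noteq> 0\<close> \<open>l \<noteq> 0\<close> show ?thesis by (cases j; cases l) simp_all
    qed
  qed
  have f_par: "f (prod_encode (comb_par (i, j))) = (case comb_par (i, j) of (k, l) \<Rightarrow> g k l)" for i j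
    by (simp add: f_def)
  have step: "f u = f (prod_encode (comb_par (prod_decode u))) \<or>
      {f u, f (prod_encode (comb_par (prod_decode u)))} \<in> gedges G"
    if "u \<in> prod_encode ` comb_verts A" "u \<noteq> prod_encode (0, 0)" for u
  proof -
    from that obtain i j where "u = prod_encode (i, j)" "i < length M" "(i, j) \<noteq> (0, 0)"
      using len(1) by (auto simp: comb_verts_def)
    with par_edge[of i j] show ?thesis by (simp add: f_par f_enc)
  qed
  show ?thesis
    unfolding comb_def
  proof (rule rooted_contraction_of_tree[OF U.simple U.connected G])
    show "f ` gverts U.T = gverts G" using verts by simp
    show "groot G = f (groot U.T)" using root f_enc by simp
    show "f u = f v \<or> {f u, f v} \<in> gedges G" if "{u, v} \<in> gedges U.T" for u v
      using that
    proof (cases rule: U.edge_cases)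
      case 1
      with step[of u] show ?thesis by simp
    next
      case 2
      with step[of v] show ?thesis by (auto simp: insert_commute)
    qed
    show "(u, v) \<in> {(x, y). (x, y) \<in> adj U.T \<and> f x = f y}\<^sup>*"
      if uv: "u \<in> gverts U.T" "v \<in> gverts U.T" "f u = f v" for u v
    proof (rule U.connected_fibres[OF _ uv[unfolded parent_graph_simps]])
      fix u v assume uv: "u \<in> prod_encode ` comb_verts A" "v \<in> prod_encode ` comb_verts A"
        "u = prod_encode (0, 0) \<or> f (prod_encode (comb_par (prod_decode u))) \<noteq> f u"
        "v = prod_encode (0, 0) \<or> f (prod_encode (comb_par (prod_decode v))) \<noteq> f v" "f u = f v"
      then obtain i j k l where "u = prod_encode (i, j)" "v = prod_encode (k, l)"
        "i < length M" "k < length M"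
        using len(1) by (auto simp: comb_verts_def)
      with uv fibres[of i j k l] show "u = v"
        by (simp add: f_par f_enc)
    qed
  qed
qed

section \<open>Layouts of brushes\<close>

text \<open>Lets a column be inserted beside one with the same head without changing the
  spine.\<close>

lemma remdups_adj_append_dup: "remdups_adj (xs @ a # a # ys) = remdups_adj (xs @ a # ys)"
  by (subst (1 2) remdups_adj_append) simp

text \<open>A layout covering the most vertices covers all of them. Otherwise take an edge from a
  covered \<open>u\<close> to an uncovered \<open>v\<close>: if \<open>u\<close> is on the spine or
  ends its column, the layout can be enlarged; otherwise \<open>u\<close> is a branch vertex off the
  spine, which a brush forbids.\<close>

lemma brush_layout:
  assumes "rooted_brush G"
  obtains p M where "graph_path G p" "hd p = groot G" "layout G p M"
    "set p \<union> set (concat (map tl M)) = gverts G" "length M \<le> card (gverts G)"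
proof -
  from assms have tree: "rooted_tree G" by (simp add: rooted_brush_def)
  then have simple: "simple_graph G" and conn: "connected_graph G"
    by (simp_all add: rooted_tree_def)
  from assms obtain p where p: "graph_path G p" "hd p = groot G"
    and branch: "{v \<in> gverts G. degree G v > 2} \<subseteq> set p"
    by (auto simp: rooted_brush_def)
  have p': "p \<noteq> []" "set p \<subseteq> gverts G" "distinct p"
    using p by (auto simp: graph_path_def walk_def)
  have fin: "finite (gverts G)" using simple by (simp add: simple_graph_def)
  \<comment> \<open>The last conjunct bounds the number of columns by the number of covered
    vertices. It holds for the one-vertex columns of \<open>p\<close> and persists because every
    added column covers a new vertex.\<close>
  define P where "P = (\<lambda>M. layout G p M \<and> set (concat (map tl M)) \<subseteq> gverts G \<and>
    length M \<le> length (p @ concat (map tl M)))"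
  have bound: "length (p @ concat (map tl M)) \<le> card (gverts G)" if "P M" for M
  proof -
    have "distinct (p @ concat (map tl M))" "set (p @ concat (map tl M)) \<subseteq> gverts G"
      using that p'(2) unfolding P_def layout_def by simp_all
    then show ?thesis
      using card_mono[OF fin] distinct_card by metis
  qed
  have tails: "concat (map tl (map (\<lambda>x. [x]) p)) = []"
    by simp
  have heads: "map hd (map (\<lambda>x. [x]) p) = p"
    by (simp add: comp_def)
  have "P (map (\<lambda>x. [x]) p)"
    unfolding P_def layout_def tails heads using p'(3) by (auto simp: remdups_adj_distinct)
  moreover have "\<forall>M. P M \<longrightarrow> length (p @ concat (map tl M)) < Suc (card (gverts G))"
    unfolding less_Suc_eq_le by (intro allI impI bound)
  ultimately have "\<exists>M. P M \<and>
      (\<forall>M'. P M' \<longrightarrow> length (p @ concat (map tl M')) \<le> length (p @ concat (map tl M)))"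
    by (rule Lattices_Big.ex_has_greatest_nat)
  then obtain M where M: "P M"
    and maximal: "\<And>M'. P M' \<Longrightarrow> length (p @ concat (map tl M')) \<le> length (p @ concat (map tl M))"
    by blast
  have lay: "\<And>Q. Q \<in> set M \<Longrightarrow> Q \<noteq> []"
    "\<And>Q. Q \<in> set M \<Longrightarrow> successively (\<lambda>u v. {u, v} \<in> gedges G) Q"
    "remdups_adj (map hd M) = p" "distinct (p @ concat (map tl M))"
    "set (concat (map tl M)) \<subseteq> gverts G" "length M \<le> length (p @ concat (map tl M))"
    using M by (auto simp: P_def layout_def)
  have "set (p @ concat (map tl M)) = gverts G"
  proof (rule ccontr)
    let ?W = "set (p @ concat (map tl M))"
    assume "?W \<noteq> gverts G"
    moreover have "?W \<subseteq> gverts G" "?W \<noteq> {}" using lay(5) p' by auto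
    ultimately obtain u v where uv: "u \<in> ?W" "v \<in> gverts G - ?W" "{u, v} \<in> gedges G"
      using crossing_edge[OF simple conn, of ?W] by blast
    have "\<exists>M'. P M' \<and> length (concat (map tl M')) = Suc (length (concat (map tl M)))"
    proof (cases "u \<in> set p")
      case True
      then have "u \<in> set (map hd M)" unfolding lay(3)[symmetric] by simp
      then obtain as Q bs where split: "M = as @ Q # bs" "hd Q = u"
        by (auto dest: split_list)
      \<comment> \<open>A new column hanging at the same spine vertex \<open>u\<close>, placed right
        after an existing one.\<close>
      let ?M = "as @ Q # [u, v] # bs"
      have "remdups_adj (map hd ?M) = p"
        using lay(3) split(2) unfolding split(1) by (simp add: remdups_adj_append_dup)
      moreover have "distinct (p @ concat (map tl ?M))"
        using lay(4) uv(2) unfolding split(1) by auto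
      moreover have "\<forall>Q\<in>set ?M. Q \<noteq> [] \<and> successively (\<lambda>u v. {u, v} \<in> gedges G) Q"
        using lay(1,2) uv(3) unfolding split(1) by auto
      ultimately have "P ?M"
        using lay(5,6) uv(2) unfolding P_def layout_def split(1) by auto
      then show ?thesis
        by (intro exI[of _ ?M]) (simp add: split(1))
    next
      case False
      with uv(1) obtain Q where Q: "Q \<in> set M" "u \<in> set (tl Q)" by auto
      obtain as bs where split: "M = as @ Q # bs" using Q(1) by (meson split_list)
      obtain cs ds where tlQ: "tl Q = cs @ u # ds" using Q(2) by (meson split_list)
      obtain x where xQ: "Q = x # cs @ u # ds" using lay(1)[OF Q(1)] tlQ by (cases Q) auto
      have succ: "successively (\<lambda>u v. {u, v} \<in> gedges G) Q" by (rule lay(2)[OF Q(1)])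
      have "x \<in> set (map hd M)" unfolding split xQ by simp
      then have x: "x \<in> set p" unfolding lay(3)[symmetric] by simp
      show ?thesis
      proof (cases ds)
        case Nil
        let ?M = "as @ (Q @ [v]) # bs"
        have "remdups_adj (map hd ?M) = p"
          using lay(3) unfolding split(1) xQ by simp
        moreover have "distinct (p @ concat (map tl ?M))"
          using lay(4) uv(2) unfolding split(1) xQ by auto
        moreover have "last Q = u" unfolding xQ Nil by simp
        then have "successively (\<lambda>u v. {u, v} \<in> gedges G) (Q @ [v])"
          using succ uv(3) by (simp add: successively_append_iff)
        then have "\<forall>Q\<in>set ?M. Q \<noteq> [] \<and> successively (\<lambda>u v. {u, v} \<in> gedges G) Q"
          using lay(1,2) unfolding split(1) by auto
        ultimately have "P ?M"
          using lay(5,6) uv(2) unfolding P_def layout_def split(1) xQ by auto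
        then show ?thesis
          by (intro exI[of _ ?M]) (simp add: split(1) xQ)
      next
        case (Cons d ds')
        \<comment> \<open>The predecessor of \<open>u\<close> in its column, possibly the spine
          vertex \<open>x\<close>. Together with \<open>d\<close> and \<open>v\<close> it gives
          \<open>u\<close> three neighbours.\<close>
        let ?l = "last (x # cs)"
        have "successively (\<lambda>u v. {u, v} \<in> gedges G) ((x # cs) @ u # d # ds')"
          using succ unfolding xQ Cons by simp
        then have edges: "{?l, u} \<in> gedges G" "{u, d} \<in> gedges G"
          unfolding successively_append_iff by simp_all
        have dist: "distinct (p @ cs @ u # d # ds')"
          using lay(4) unfolding split xQ Cons by auto
        have "?l \<in> set (x # cs)" by (rule last_in_set) simp
        then have "?l \<noteq> d" "?l \<noteq> v" "d \<noteq> v"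
          using dist x uv(2) unfolding split xQ Cons by auto
        moreover have "u \<noteq> v" "u \<noteq> d" "u \<noteq> ?l"
          using simple_graph_edgeD(3)[OF simple] uv(3) edges by blast+
        ultimately have "card {{?l, u}, {u, d}, {u, v}} = 3"
          by (simp add: doubleton_eq_iff card_insert_if)
        moreover have "card {{?l, u}, {u, d}, {u, v}} \<le> degree G u"
          unfolding degree_def
        proof (rule card_mono)
          show "finite {e \<in> gedges G. u \<in> e}"
            using finite_gedges[OF simple] by simp
          show "{{?l, u}, {u, d}, {u, v}} \<subseteq> {e \<in> gedges G. u \<in> e}"
            using edges uv(3) by simp
        qed
        moreover have "u \<in> gverts G" by (rule simple_graph_edgeD(1)[OF simple uv(3)])
        ultimately have "u \<in> set p" by (intro subsetD[OF branch]) simp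
        with False show ?thesis by simp
      qed
    qed
    then obtain M' where "P M'" "length (concat (map tl M')) = Suc (length (concat (map tl M)))"
      by blast
    with maximal[of M'] show False by simp
  qed
  then have "set p \<union> set (concat (map tl M)) = gverts G" by simp
  moreover have "layout G p M" using M by (simp add: P_def)
  moreover have "length M \<le> card (gverts G)"
    using lay(6) bound[OF M] by simp
  ultimately show thesis using that p by blast
qed

section \<open>The ruler sequence\<close>

text \<open>Counting from 1, the entry at position \<open>k\<close> is twice the largest power of 2
  dividing \<open>k\<close>. The middle entry \<open>2 ^ Suc q\<close> is large enough for any
  single entry of a list of sum below \<open>2 ^ Suc q\<close>.\<close>

fun ruler :: "nat \<Rightarrow> nat list" where
  "ruler 0 = []"
| "ruler (Suc q) = ruler q @ 2 ^ Suc q # ruler q"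

lemma sum_list_ruler: "sum_list (ruler q) = q * 2 ^ q"
  by (induction q) (simp_all add: algebra_simps)

lemma zero_notin_ruler: "0 \<notin> set (ruler q)"
  by (induction q) auto

lemma split_at_sum:
  fixes xs :: "nat list"
  assumes "0 < n" "n \<le> sum_list xs"
  shows "\<exists>ys x zs. xs = ys @ x # zs \<and> sum_list ys < n \<and> n \<le> sum_list ys + x"
  using assms(2)
proof (induction xs rule: rev_induct)
  case (snoc x xs)
  show ?case
  proof (cases "n \<le> sum_list xs")
    case True
    with snoc.IH show ?thesis by fastforce
  next
    case False
    with snoc.prems show ?thesis
      by (intro exI[of _ xs] exI[of _ x] exI[of _ "[]"]) simp
  qed
qed (use assms(1) in simp)

text \<open>The entry at which the running sum reaches \<open>2 ^ q\<close> goes to the middle of the ruler;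
  the parts before and after it both have sum below \<open>2 ^ q\<close>.\<close>

lemma list_emb_ruler:
  assumes "0 \<notin> set xs" "sum_list xs < 2 ^ q"
  shows "list_emb (\<le>) xs (ruler q)"
  using assms
proof (induction q arbitrary: xs)
  case 0
  then show ?case by (cases xs) auto
next
  case (Suc q)
  show ?case
  proof (cases "sum_list xs < 2 ^ q")
    case True
    \<comment> \<open>A small sum already fits into the left copy of \<open>ruler q\<close>.\<close>
    with Suc show ?thesis by (simp add: list_emb_prefix)
  next
    case False
    then obtain ys x zs where xs: "xs = ys @ x # zs" "sum_list ys < 2 ^ q" "2 ^ q \<le> sum_list ys + x"
      using split_at_sum[of "2 ^ q" xs] by auto
    \<comment> \<open>At least \<open>2 ^ q\<close> of a total below \<open>2 * 2 ^ q\<close> is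
      used up by \<open>ys\<close> and \<open>x\<close>.\<close>
    with Suc.prems(2) have "sum_list zs < 2 ^ q" "x \<le> 2 ^ Suc q" by simp_all
    with Suc xs show ?thesis
      by (simp add: list_emb_append_mono list_emb_Cons2)
  qed
qed

text \<open>Entries of \<open>A\<close> skipped by the embedding receive the one-vertex column
  \<open>[c]\<close>, where \<open>c\<close> is the preceding head: it repeats that head and has an
  empty tail, so spine and tails are unchanged. The variable \<open>c\<close> is general because the
  preceding head changes along the list.\<close>

lemma pad_columns:
  assumes "list_emb (\<le>) (map length N) A" "0 \<notin> set A"
  shows "\<exists>M. list_all2 (\<lambda>Q a. length Q \<le> a) M A \<and> set M \<subseteq> set N \<union> range (\<lambda>x. [x]) \<and>
    remdups_adj (c # map hd M) = remdups_adj (c # map hd N) \<and>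
    concat (map tl M) = concat (map tl N)"
  using assms
proof (induction "map length N" A arbitrary: N c rule: list_emb.induct)
  case (list_emb_Nil ys)
  have "map hd (map (\<lambda>_. [c]) ys) = replicate (length ys) c"
    by (simp add: map_replicate_const comp_def)
  then have "remdups_adj (c # map hd (map (\<lambda>_. [c]) ys)) = [c]"
    using remdups_adj_replicate[of "Suc (length ys)" c] by simp
  moreover have "Suc 0 \<le> y" if "y \<in> set ys" for y
    using list_emb_Nil that by (cases y) auto
  then have "list_all2 (\<lambda>Q a. length Q \<le> a) (map (\<lambda>_. [c]) ys) ys"
    by (simp add: list_all2_conv_all_nth)
  ultimately show ?case
    using list_emb_Nil by (intro exI[of _ "map (\<lambda>_. [c]) ys"]) auto
next
  case (list_emb_Cons ys y)
  obtain M where "list_all2 (\<lambda>Q a. length Q \<le> a) M ys" "set M \<subseteq> set N \<union> range (\<lambda>x. [x])"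
    "remdups_adj (c # map hd M) = remdups_adj (c # map hd N)"
    "concat (map tl M) = concat (map tl N)"
    using list_emb_Cons(2)[of N c] list_emb_Cons.prems by auto
  moreover have "Suc 0 \<le> y" using list_emb_Cons.prems by (cases y) auto
  ultimately show ?case
    by (intro exI[of _ "[c] # M"]) auto
next
  case (list_emb_Cons2 x y xs ys)
  from \<open>x # xs = map length N\<close> obtain Q N' where N: "N = Q # N'" "x = length Q" "xs = map length N'"
    by (cases N) auto
  obtain M where "list_all2 (\<lambda>Q a. length Q \<le> a) M ys" "set M \<subseteq> set N' \<union> range (\<lambda>x. [x])"
    "remdups_adj (hd Q # map hd M) = remdups_adj (hd Q # map hd N')"
    "concat (map tl M) = concat (map tl N')"
    using list_emb_Cons2(3)[of N' "hd Q"] N(3) list_emb_Cons2.prems by auto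
  then show ?case
    using list_emb_Cons2(1) N by (intro exI[of _ "Q # M"]) auto
qed

section \<open>The universal brush\<close>

text \<open>A brush with \<open>m\<close> edges has at most \<open>m + 1\<close> vertices, hence at
  most \<open>m + 1\<close> columns and at most \<open>m + 1\<close> vertices in the tails, so the
  column lengths sum to at most \<open>2 * m + 2\<close>. The leading column of size 1 is the root,
  which supplies the first head for the padding.\<close>

lemma universal_brush_comb:
  assumes "2 * m + 3 \<le> 2 ^ q"
  shows "universal_brush m (comb (1 # ruler q))"
proof -
  have A: "1 # ruler q \<noteq> []" "0 \<notin> set (1 # ruler q)"
    using zero_notin_ruler by auto
  have brush: "rooted_brush (comb (1 # ruler q))"
    by (rule comb_brush[OF A])
  have "rooted_contraction T (comb (1 # ruler q))"
    if T: "rooted_brush T" "card (gedges T) = m" for T :: "nat rooted_graph"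
  proof -
    from brush_layout[OF T(1)] obtain p M where
      p: "graph_path T p" "hd p = groot T" and lay: "layout T p M"
      and cover: "set p \<union> set (concat (map tl M)) = gverts T" and lenM: "length M \<le> card (gverts T)"
      by blast
    have tree: "rooted_tree T" using T(1) by (simp add: rooted_brush_def)
    then have simple: "simple_graph T" "connected_graph T" by (simp_all add: rooted_tree_def)
    have M: "\<And>Q. Q \<in> set M \<Longrightarrow> Q \<noteq> []" "remdups_adj (map hd M) = p"
      "distinct (concat (map tl M))"
      using lay by (auto simp: layout_def)
    have cardV: "card (gverts T) \<le> m + 1"
      using card_gverts_le[OF simple] T(2) by simp
    have "length (concat (map tl M)) \<le> card (gverts T)"
      using cover simple(1) M(3) unfolding simple_graph_def
      by (metis card_mono distinct_card sup_ge2)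
    moreover have "sum_list (map length M) = length M + length (concat (map tl M))"
      using M(1) by (induction M) (auto simp: length_concat Suc_le_eq)
    ultimately have "sum_list (map length M) < 2 ^ q"
      using lenM cardV assms by linarith
    moreover have "0 \<notin> set (map length M)"
      using M(1) by auto
    ultimately have "list_emb (\<le>) (map length M) (ruler q)"
      by (intro list_emb_ruler)
    from pad_columns[OF this zero_notin_ruler, of "groot T"]
    obtain M' where M': "list_all2 (\<lambda>Q a. length Q \<le> a) M' (ruler q)"
      "set M' \<subseteq> set M \<union> range (\<lambda>x. [x])"
      "remdups_adj (groot T # map hd M') = remdups_adj (groot T # map hd M)"
      "concat (map tl M') = concat (map tl M)"
      by blast
    have "p \<noteq> []" using p by (simp add: graph_path_def walk_def)
    then have "map hd M \<noteq> []" using M(2) by auto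
    \<comment> \<open>The spine already begins at the root, so the extra root column disappears
      among adjacent repetitions.\<close>
    moreover have "hd (map hd M) = groot T"
      using p(2) M(2) hd_remdups_adj by metis
    ultimately have "remdups_adj (groot T # map hd M) = remdups_adj (map hd M)"
      by (cases "map hd M") auto
    then have "layout T p ([groot T] # M')"
      using lay M'(2,3,4) by (fastforce simp: layout_def)
    then show ?thesis
      using cover M'(1,4) by (intro comb_contraction[OF tree p, of "[groot T] # M'"]) auto
  qed
  with brush show ?thesis
    by (simp add: universal_brush_def strongly_universal_def rooted_brush_def)
qed

section \<open>The size of the universal brush and its growth\<close>

lemma min_brush_edges_le:
  "real (min_brush_edges m) \<le> (log 2 (2 * real m + 3) + 1) * (4 * real m + 6)"
proof -
  \<comment> \<open>The smallest admissible power of 2 exceeds the required bound by less than a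
    factor of 2.\<close>
  obtain n where n: "2 ^ n < 2 * m + 3" "2 * m + 3 \<le> 2 ^ (n + 1)"
    using ex_power_ivl2[of 2 "2 * m + 3"] by auto
  let ?A = "1 # ruler (n + 1)"
  \<comment> \<open>The leading entry 1 cancels the difference between the numbers of vertices and
    edges.\<close>
  have "card (gedges (comb ?A)) = (n + 1) * 2 ^ (n + 1)"
    using card_comb_edges[of ?A] zero_notin_ruler[of "n + 1"] sum_list_ruler[of "n + 1"] by auto
  then have "min_brush_edges m \<le> (n + 1) * 2 ^ (n + 1)"
    unfolding min_brush_edges_def using universal_brush_comb[OF n(2)] by (intro Least_le) blast
  then have "real (min_brush_edges m) \<le> real ((n + 1) * 2 ^ (n + 1))"
    by (rule of_nat_mono)
  also have "\<dots> = (real n + 1) * (2 * 2 ^ n)"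
    by (simp add: algebra_simps)
  also have "\<dots> \<le> (log 2 (2 * real m + 3) + 1) * (4 * real m + 6)"
  proof -
    have "real (2 ^ n) < real (2 * m + 3)"
      using n(1) by (simp only: of_nat_less_iff)
    then have less: "(2::real) ^ n < 2 * real m + 3" by simp
    then have "real n \<le> log 2 (2 * real m + 3)"
      by (simp add: le_log_iff powr_realpow)
    with less show ?thesis by (intro mult_mono) auto
  qed
  finally show ?thesis .
qed

text \<open>The existence half ensures that the \<open>LEAST\<close> in
  \<open>min_brush_edges\<close> ranges over a nonempty set.\<close>

theorem theorem4:
  "(\<forall>m. \<exists>U. universal_brush m U) \<and>
   (\<lambda>m. real (min_brush_edges m)) \<in> O(\<lambda>m. real m * ln (real m))"
proof (intro conjI allI)
  fix m :: nat
  have "2 * m + 3 \<le> 2 ^ (2 * m + 3)"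
    by (rule less_imp_le[OF less_exp])
  from universal_brush_comb[OF this] show "\<exists>U. universal_brush m U"
    by blast
next
  have "(\<lambda>m. real (min_brush_edges m)) \<in> O(\<lambda>m. (log 2 (2 * real m + 3) + 1) * (4 * real m + 6))"
    using min_brush_edges_le
    by (intro bigoI[of _ 1] always_eventually) (auto intro: order_trans[OF _ abs_ge_self])
  also have "(\<lambda>m. (log 2 (2 * real m + 3) + 1) * (4 * real m + 6)) \<in> O(\<lambda>m. real m * ln (real m))"
    by real_asymp
  finally show "(\<lambda>m. real (min_brush_edges m)) \<in> O(\<lambda>m. real m * ln (real m))" .
qed

end
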